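(* Let $A\in\mathbb{R}^{m\times n}$ be a nonzero matrix and let $b\in\mathbb{R}^m$ be arbitrary (the linear system $Ax=b$ may be consistent or inconsistent, and $A$ may have any rank). Let $\{x^k\}_{k=0}^{\infty}$ be the random sequence generated by the randomized Kaczmarz method with adaptive stepsizes (RKAS) applied to $Ax=b$ with $x^0=0$. Then for every $k\ge 0$, $$\mathbb{E}\left[\left\|Ax^k-AA^\dagger b\right\|^2_2\right]\leq \left(1-\frac{\sigma_{\min}^4(A)}{\|A\|_2^2\,\|A\|_F^2}\right)^k\left\|Ax^0-AA^\dagger b\right\|^2_2.$$
   Context: Notation: $A_{i,:}$ is the $i$-th row of $A$ (a row vector), $A^\top$ the transpose, $A^\dagger$ the Moore-Penrose pseudoinverse, $\|A\|_2$ the spectral norm, $\|A\|_F$ the Frobenius norm, $\sigma_{\min}(A)>0$ the smallest nonzero singular value of $A$, and $\|\cdot\|_2$ and $\langle\cdot,\cdot\rangle$ the Euclidean norm and inner product on vectors. RKAS algorithm: start with $x^0=0\in\mathbb{R}^n$ and $r^0=Ax^0-b=-b$. For $k=0,1,2,\dots$: (1) select a random index $i_k\in\{1,\dots,m\}$, independently of the previous selections, with $\Pr(i_k=i)=\|A_{i,:}\|_2^2/\|A\|_F^2$ (so zero rows are selected with probability zero); (2) compute $\alpha_k=\dfrac{\langle AA_{i_k,:}^\top,\,r^k\rangle}{\|AA_{i_k,:}^\top\|_2^2}$; (3) update $x^{k+1}=x^k-\alpha_kA_{i_k,:}^\top$ and $r^{k+1}=r^k-\alpha_kAA_{i_k,:}^\top$.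 The algorithm is run without a stopping rule, and the expectation is over the random choices $i_0,i_1,\dots$. *)

theory Defs
  imports "HOL-Analysis.Analysis" "HOL-Probability.Probability"
begin

definition frobenius_norm :: "real^'n^'m \<Rightarrow> real" where
  "frobenius_norm A = sqrt (\<Sum>i\<in>UNIV. \<Sum>j\<in>UNIV. (A $ i $ j)\<^sup>2)"

definition spectral_norm :: "real^'n^'m \<Rightarrow> real" where
  "spectral_norm A = onorm (\<lambda>x. A *v x)"

text \<open>
  The spectrum of \<open>A\<^sup>T A\<close> is used, so for \<open>n > m\<close> the value \<open>0\<close> is included in addition to the
  \<open>min m n\<close> usual singular values; the nonzero ones are not affected.
\<close>

definition singular_values :: "real^'n^'m \<Rightarrow> real set" where
  "singular_values A =
     {sqrt l | l. \<exists>v. v \<noteq> 0 \<and> (transpose A ** A) *v v = l *\<^sub>R v}"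

definition sigma_min :: "real^'n^'m \<Rightarrow> real" where
  "sigma_min A = Min {s \<in> singular_values A. s \<noteq> 0}"

definition is_pseudoinverse :: "real^'n^'m \<Rightarrow> real^'m^'n \<Rightarrow> bool" where
  "is_pseudoinverse A X \<longleftrightarrow>
     A ** X ** A = A \<and> X ** A ** X = X \<and>
     transpose (A ** X) = A ** X \<and> transpose (X ** A) = X ** A"

definition pseudoinverse :: "real^'n^'m \<Rightarrow> real^'m^'n" where
  "pseudoinverse A = (THE X. is_pseudoinverse A X)"

text \<open>
  If \<open>A *v row i A = 0\<close>, equivalently \<open>row i A = 0\<close>, then division by zero makes the stepsize \<open>0\<close>
  and the step leaves the state unchanged. Such rows are selected with probability zero.
\<close>

definition rkas_step ::
    "real^'n^'m \<Rightarrow> 'm \<Rightarrow> (real^'n) \<times> (real^'m) \<Rightarrow> (real^'n) \<times> (real^'m)" where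
  "rkas_step A i = (\<lambda>(x, r).
     let \<alpha> = ((A *v row i A) \<bullet> r) / (norm (A *v row i A))\<^sup>2
     in (x - \<alpha> *\<^sub>R row i A, r - \<alpha> *\<^sub>R (A *v row i A)))"

primrec rkas_state ::
    "real^'n^'m \<Rightarrow> real^'m \<Rightarrow> (nat \<Rightarrow> 'm) \<Rightarrow> nat \<Rightarrow> (real^'n) \<times> (real^'m)" where
  "rkas_state A b idx 0 = (0, A *v 0 - b)"
| "rkas_state A b idx (Suc k) = rkas_step A (idx k) (rkas_state A b idx k)"

definition rkas_iterate ::
    "real^'n^'m \<Rightarrow> real^'m \<Rightarrow> (nat \<Rightarrow> 'm) \<Rightarrow> nat \<Rightarrow> real^'n" where
  "rkas_iterate A b idx k = fst (rkas_state A b idx k)"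

definition (in prob_space) rkas_selection :: "real^'n^'m \<Rightarrow> (nat \<Rightarrow> 'a \<Rightarrow> 'm) \<Rightarrow> bool" where
  "rkas_selection A idx \<longleftrightarrow>
     indep_vars (\<lambda>_. count_space UNIV) idx UNIV \<and>
     (\<forall>k i. prob {\<omega> \<in> space M. idx k \<omega> = i} = (norm (row i A))\<^sup>2 / (frobenius_norm A)\<^sup>2)"

text \<open>The expected squared error is thus never the default value of a divergent integral.\<close>

lemma (in prob_space) integrable_rkas_error:
  fixes A :: "real^'n^'m" and b c :: "real^'m"
  assumes "rkas_selection A idx"
  shows "integrable M (\<lambda>\<omega>. (norm (A *v rkas_iterate A b (\<lambda>j. idx j \<omega>) k - c))\<^sup>2)"
proof -
  have idx: "idx j \<in> measurable M (count_space UNIV)" for j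
    using assms by (auto simp: rkas_selection_def indep_vars_def)
  have "simple_function M (idx j)" for j
    unfolding simple_function_def using measurable_sets[OF idx[of j]]
    by (auto intro: finite_subset[OF subset_UNIV])
  then have "simple_function M (\<lambda>\<omega>. rkas_state A b (\<lambda>j. idx j \<omega>) k)"
    by (induction k) (auto intro: simple_function_compose2)
  then have simple: "simple_function M
      (\<lambda>\<omega>. (norm (A *v rkas_iterate A b (\<lambda>j. idx j \<omega>) k - c))\<^sup>2)" (is "simple_function M ?f")
    unfolding rkas_iterate_def by (rule simple_function_compose1)
  then have fin: "finite (?f ` space M)"
    by (simp add: simple_function_def)
  show ?thesis
  proof (rule integrable_const_bound)
    show "AE \<omega> in M. norm (?f \<omega>) \<le> Max (?f ` space M)"
      using fin by (intro AE_I2) simp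
    show "?f \<in> borel_measurable M"
      using simple by (rule borel_measurable_simple_function)
  qed
qed

end

theory Submission
  imports Defs
begin

text \<open>
  A step replaces the error \<open>e = A x - A A\<^sup>\<dagger> b\<close>, which lies in the range of \<open>A\<close>, by its projection
  orthogonal to \<open>u = A a\<close> for the selected row \<open>a\<close>, so \<open>\<parallel>e\<parallel>\<^sup>2\<close> drops by \<open>\<langle>u, e\<rangle>\<^sup>2 / \<parallel>u\<parallel>\<^sup>2\<close>. The row
  probabilities and \<open>\<parallel>u\<parallel> \<le> \<parallel>A\<parallel> \<parallel>a\<parallel>\<close> make the expected drop at least
  \<open>\<parallel>A A\<^sup>T e\<parallel>\<^sup>2 / (\<parallel>A\<parallel>\<^sup>2 \<parallel>A\<parallel>\<^sub>F\<^sup>2)\<close>, and \<open>\<parallel>A A\<^sup>T e\<parallel> \<ge> \<sigma>\<^sub>m\<^sub>i\<^sub>n\<^sup>2 \<parallel>e\<parallel>\<close> on the range of \<open>A\<close>.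
\<close>

text \<open>This rule would rewrite \<open>transpose A *v x\<close> to \<open>x v* A\<close>, hiding
  the adjoint from the lemmas below.\<close>

declare transpose_matrix_vector [simp del]

section \<open>Adjoints, row space and the normal equation\<close>

lemma matrix_vector_adjoint:
  fixes A :: "real^'n^'m"
  shows "(A *v x) \<bullet> y = x \<bullet> (transpose A *v y)"
  by (metis dot_lmul_matrix inner_commute transpose_matrix_vector)

text \<open>Pairing the assumption with \<open>y\<close> gives the squared norm of
  \<open>transpose A *v y\<close>.\<close>

lemma mult_transpose_eq_0:
  fixes A :: "real^'n^'m"
  assumes "A *v (transpose A *v y) = 0"
  shows "transpose A *v y = 0"
proof -
  have "(transpose A *v y) \<bullet> (transpose A *v y) = 0"
    using matrix_vector_adjoint[of A "transpose A *v y" y] assms by simp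
  then show ?thesis by simp
qed

lemma subspace_range_matrix: "subspace (range ((*v) (A :: real^'n^'m)))"
  by (intro linear_subspace_image) auto

text \<open>The orthogonal complement of the row space is contained in the kernel, so the part of
  \<open>x\<close> outside the row space is killed by \<open>A\<close>.\<close>

lemma kernel_row_space_decomp:
  fixes A :: "real^'n^'m"
  obtains y where "A *v (x - transpose A *v y) = 0"
proof -
  let ?R = "range ((*v) (transpose A))"
  obtain p q where p: "p \<in> span ?R" and q: "\<And>w. w \<in> span ?R \<Longrightarrow> orthogonal q w"
    and x: "x = p + q"
    using orthogonal_subspace_decomp_exists[of ?R x] by blast
  have span: "span ?R = ?R"
    using subspace_range_matrix by (simp add: span_eq_iff)
  obtain y where y: "p = transpose A *v y"
    using p span by auto
  have "q \<bullet> (transpose A *v (A *v q)) = 0"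
    using q span by (auto simp: orthogonal_def)
  then have "A *v q = 0"
    using matrix_vector_adjoint[of A q "A *v q"] by simp
  then have "A *v (x - transpose A *v y) = 0"
    using x y by simp
  then show thesis using that by blast
qed

text \<open>Two decompositions: \<open>y\<close> is projected to some \<open>A *v z\<close>, then
  \<open>z\<close> is replaced by its row-space part, which has the same image under
  \<open>A\<close>.\<close>

lemma normal_equation_solvable:
  fixes A :: "real^'n^'m"
  obtains u where "transpose A *v (A *v (transpose A *v u)) = transpose A *v y"
proof -
  obtain z where z: "transpose A *v (y - A *v z) = 0"
    using kernel_row_space_decomp[of "transpose A" y] by auto
  obtain u where u: "A *v (z - transpose A *v u) = 0"
    using kernel_row_space_decomp by blast
  have "transpose A *v (A *v (transpose A *v u)) = transpose A *v y"
    using z u by (simp add: matrix_vector_mult_diff_distrib)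
  then show thesis using that by blast
qed

text \<open>The difference of two solutions lies in the row space and in the kernel of
  \<open>A\<close>, which meet only in 0.\<close>

lemma normal_equation_unique:
  fixes A :: "real^'n^'m"
  assumes "x \<in> range ((*v) (transpose A))" "x' \<in> range ((*v) (transpose A))"
    and "transpose A *v (A *v x) = transpose A *v (A *v x')"
  shows "x = x'"
proof -
  obtain u where u: "x - x' = transpose A *v u"
    using assms(1,2) by (metis (no_types, lifting) imageE matrix_vector_mult_diff_distrib)
  have "transpose A *v (A *v (x - x')) = 0"
    using assms(3) by (simp add: matrix_vector_mult_diff_distrib)
  then have "A *v (x - x') = 0"
    using mult_transpose_eq_0[of "transpose A" "x - x'"] by simp
  then show ?thesis
    using mult_transpose_eq_0[of A u] u by simp
qed

section \<open>The Moore-Penrose pseudoinverse\<close>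

text \<open>The witness sends \<open>y\<close> to the unique solution of the normal equation in the
  row space; uniqueness makes this map linear.\<close>

lemma ex_is_pseudoinverse: "\<exists>X. is_pseudoinverse (A :: real^'n^'m) X"
proof -
  let ?T = "transpose A"
  let ?R = "range ((*v) ?T)"
  have "\<exists>x. x \<in> ?R \<and> ?T *v (A *v x) = ?T *v y" for y
    using normal_equation_solvable[of A y] by (metis rangeI)
  then obtain f where fR: "\<And>y. f y \<in> ?R" and f: "\<And>y. ?T *v (A *v f y) = ?T *v y"
    by metis
  have unique: "x = f y" if "x \<in> ?R" "?T *v (A *v x) = ?T *v y" for x y
    using normal_equation_unique[of x A "f y"] that fR f by simp
  have R: "subspace ?R" by (rule subspace_range_matrix)
  have "f (y + z) = f y + f z" for y z
    by (rule unique[symmetric])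
       (auto intro: subspace_add[OF R] fR simp: matrix_vector_right_distrib f)
  moreover have "f (c *\<^sub>R y) = c *\<^sub>R f y" for c y
    by (rule unique[symmetric])
       (use subspace_scale[OF R fR] in \<open>auto simp: matrix_vector_mult_scaleR f\<close>)
  ultimately have lin: "linear f"
    by (intro linearI)
  define X where "X = matrix f"
  have X: "X *v y = f y" for y
    unfolding X_def using matrix_works lin by (metis linear_matrix_vector_mul_eq)
  have AfA: "A *v f (A *v z) = A *v z" for z
  proof -
    have "?T *v (A *v (f (A *v z) - z)) = 0"
      using f by (simp add: matrix_vector_mult_diff_distrib)
    then have "A *v (f (A *v z) - z) = 0"
      using mult_transpose_eq_0[of ?T] by simp
    then show ?thesis by (simp add: matrix_vector_mult_diff_distrib)
  qed
  \<comment> \<open>The right-hand side of the premise is symmetric in \<open>x\<close> and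
    \<open>y\<close>, hence so is the left.\<close>
  have sym: "transpose S = S" if "\<And>x y. (S *v x) \<bullet> y = (S *v x) \<bullet> (S *v y)"
    for S :: "real^'k^'k"
  proof -
    have "x \<bullet> (S *v y) = x \<bullet> (transpose S *v y)" for x y
      by (metis that inner_commute matrix_vector_adjoint)
    then show ?thesis
      by (metis matrix_eq vector_eq_rdot inner_commute)
  qed
  have "is_pseudoinverse A X"
    unfolding is_pseudoinverse_def
  proof (intro conjI)
    show "A ** X ** A = A"
      by (simp add: matrix_eq matrix_vector_mul_assoc[symmetric] X AfA)
    have "f (A *v f y) = f y" for y
      by (rule unique[symmetric]) (auto simp: fR)
    then show "X ** A ** X = X"
      by (simp add: matrix_eq matrix_vector_mul_assoc[symmetric] X)
    show "transpose (A ** X) = A ** X"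
    proof (rule sym)
      show "((A ** X) *v x) \<bullet> y = ((A ** X) *v x) \<bullet> ((A ** X) *v y)" for x y
        by (simp add: matrix_vector_mul_assoc[symmetric] X matrix_vector_adjoint f)
    qed
    show "transpose (X ** A) = X ** A"
    proof (rule sym)
      fix x y
      obtain u where u: "f (A *v x) = ?T *v u"
        using fR by (metis imageE)
      show "((X ** A) *v x) \<bullet> y = ((X ** A) *v x) \<bullet> ((X ** A) *v y)"
        using matrix_vector_adjoint[of ?T u]
        by (simp add: matrix_vector_mul_assoc[symmetric] X u AfA)
    qed
  qed
  then show ?thesis by blast
qed

text \<open>Symmetry of the four products yields \<open>AX\<close> and \<open>XA\<close>; then X =
  XAX = YAY.\<close>

lemma is_pseudoinverse_unique:
  assumes X: "is_pseudoinverse (A :: real^'n^'m) X" and Y: "is_pseudoinverse A Y"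
  shows "X = Y"
proof -
  have AX: "A ** X = A ** Y"
  proof -
    have "A ** X = transpose (A ** Y ** A ** X)"
      using X Y by (simp add: is_pseudoinverse_def)
    also have "\<dots> = transpose (A ** X) ** transpose (A ** Y)"
      by (simp add: matrix_transpose_mul matrix_mul_assoc)
    also have "\<dots> = A ** X ** A ** Y"
      using X Y by (simp add: is_pseudoinverse_def matrix_mul_assoc)
    also have "\<dots> = A ** Y"
      using X by (simp add: is_pseudoinverse_def)
    finally show ?thesis .
  qed
  have XA: "X ** A = Y ** A"
  proof -
    have "X ** A = transpose (X ** (A ** Y ** A))"
      using X Y by (simp add: is_pseudoinverse_def)
    also have "\<dots> = transpose (Y ** A) ** transpose (X ** A)"
      by (metis matrix_transpose_mul matrix_mul_assoc)
    also have "\<dots> = Y ** (A ** X ** A)"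
      using X Y unfolding is_pseudoinverse_def by (metis matrix_mul_assoc)
    also have "\<dots> = Y ** A"
      using X by (simp add: is_pseudoinverse_def)
    finally show ?thesis .
  qed
  have "X = X ** A ** X"
    using X by (simp add: is_pseudoinverse_def)
  also have "\<dots> = Y ** A ** Y"
    by (metis AX XA matrix_mul_assoc)
  finally show ?thesis
    using Y by (simp add: is_pseudoinverse_def)
qed

lemma is_pseudoinverse_pseudoinverse: "is_pseudoinverse A (pseudoinverse A)"
  unfolding pseudoinverse_def
  by (rule theI') (metis ex_is_pseudoinverse is_pseudoinverse_unique)

text \<open>Since \<open>A ** pseudoinverse A\<close> is symmetric, this is the transpose of the
  first Penrose equation. It makes the target of the iteration a solution of the normal
  equation.\<close>

lemma transpose_mult_pseudoinverse:
  fixes A :: "real^'n^'m"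
  shows "transpose A *v (A *v (pseudoinverse A *v b)) = transpose A *v b"
proof -
  have "transpose A ** (A ** pseudoinverse A) = transpose A"
    using is_pseudoinverse_pseudoinverse[of A]
    unfolding is_pseudoinverse_def by (metis matrix_transpose_mul)
  then show ?thesis
    by (simp add: matrix_vector_mul_assoc matrix_mul_assoc)
qed

section \<open>Singular values and lower bounds by \<open>sigma_min\<close>\<close>

lemma norm_add_scaleR_sq:
  "(norm (x + t *\<^sub>R y))\<^sup>2 = (norm x)\<^sup>2 + 2 * t * (x \<bullet> y) + t\<^sup>2 * (norm y)\<^sup>2"
  unfolding power2_norm_eq_inner
  by (simp add: inner_add inner_commute power2_eq_square algebra_simps)

text \<open>Eigenvectors of a symmetric matrix for distinct eigenvalues are orthogonal, hence
  independent. Finiteness is what gives \<open>Min\<close> in \<open>sigma_min\<close> its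
  meaning.\<close>

lemma finite_singular_values: "finite (singular_values (A :: real^'n^'m))"
proof -
  let ?B = "transpose A ** A"
  define L where "L = {l. \<exists>v. v \<noteq> 0 \<and> ?B *v v = l *\<^sub>R v}"
  have "\<exists>v. \<forall>l\<in>L. v l \<noteq> 0 \<and> ?B *v v l = l *\<^sub>R v l"
    unfolding L_def by (intro bchoice) auto
  then obtain v where v: "\<And>l. l \<in> L \<Longrightarrow> v l \<noteq> 0" "\<And>l. l \<in> L \<Longrightarrow> ?B *v v l = l *\<^sub>R v l"
    by blast
  have orth: "v l \<bullet> v l' = 0" if "l \<in> L" "l' \<in> L" "l \<noteq> l'" for l l'
  proof -
    have "l * (v l \<bullet> v l') = (?B *v v l) \<bullet> v l'"
      using that v by simp
    also have "\<dots> = v l \<bullet> (?B *v v l')"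
      by (simp add: matrix_vector_adjoint matrix_transpose_mul)
    also have "\<dots> = l' * (v l \<bullet> v l')"
      using that v by simp
    finally show ?thesis using that by simp
  qed
  have "independent (v ` L)"
    by (rule pairwise_orthogonal_independent)
       (use orth v in \<open>auto simp: pairwise_def orthogonal_def\<close>)
  then have "finite (v ` L)"
    using independent_bound by blast
  moreover have "inj_on v L"
    by (rule inj_onI) (metis orth v(1) inner_eq_zero_iff)
  ultimately have "finite L"
    using finite_imageD by blast
  moreover have "singular_values A = sqrt ` L"
    unfolding singular_values_def L_def by auto
  ultimately show ?thesis by simp
qed

text \<open>Not automatic, as \<open>sqrt\<close> is negative at negative arguments; here
  \<open>l\<close> is nonnegative because \<open>l * (v \<bullet> v)\<close> is the squared norm of
  \<open>A *v v\<close>.\<close>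

lemma singular_values_nonneg:
  assumes "s \<in> singular_values (A :: real^'n^'m)"
  shows "0 \<le> s"
proof -
  obtain l v where s: "s = sqrt l" and v: "v \<noteq> 0" "(transpose A ** A) *v v = l *\<^sub>R v"
    using assms unfolding singular_values_def by blast
  have "(A *v v) \<bullet> (A *v v) = l * (v \<bullet> v)"
    using v by (simp add: matrix_vector_adjoint matrix_vector_mul_assoc)
  then have "0 \<le> l * (v \<bullet> v)"
    by (metis inner_ge_zero)
  then have "0 \<le> l"
    using v(1) by (metis inner_gt_zero_iff zero_le_mult_iff not_le)
  then show ?thesis using s by simp
qed

text \<open>
  The quadratic form \<open>\<parallel>A x\<parallel>\<^sup>2\<close> attains its minimum over the unit sphere of the row space; the
  minimiser is an eigenvector of \<open>A\<^sup>T A\<close> by the first-order condition.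
\<close>

lemma row_space_minimiser:
  fixes A :: "real^'n^'m"
  assumes "A \<noteq> 0"
  obtains v l where "v \<noteq> 0" "l > 0" "(transpose A ** A) *v v = l *\<^sub>R v"
    "\<And>y. l * (norm (transpose A *v y))\<^sup>2 \<le> (norm (A *v (transpose A *v y)))\<^sup>2"
proof -
  let ?T = "transpose A"
  define R where "R = range ((*v) ?T)"
  have R: "subspace R" unfolding R_def by (rule subspace_range_matrix)
  have "?T \<noteq> 0"
    using assms by (auto simp: transpose_def vec_eq_iff)
  then obtain y where y: "?T *v y \<noteq> 0"
    by (metis matrix_eq matrix_vector_mult_0)
  then have "(1 / norm (?T *v y)) *\<^sub>R (?T *v y) \<in> R \<inter> sphere 0 1"
    using subspace_scale[OF R] by (auto simp: R_def)
  then have ne: "R \<inter> sphere 0 1 \<noteq> {}" by blast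
  have "compact (R \<inter> sphere 0 1)"
    using closed_subspace[OF R] by (intro closed_Int_compact) auto
  then obtain v where v: "v \<in> R" "norm v = 1"
    and min: "\<And>x. x \<in> R \<Longrightarrow> norm x = 1 \<Longrightarrow> norm (A *v v) \<le> norm (A *v x)"
    using continuous_attains_inf[OF _ ne continuous_on_norm[OF matrix_vector_mult_linear_continuous_on[of _ A]]]
    by auto
  define l where "l = (norm (A *v v))\<^sup>2"
  have ge: "l * (norm x)\<^sup>2 \<le> (norm (A *v x))\<^sup>2" if "x \<in> R" for x
  proof (cases "x = 0")
    case False
    have "norm (A *v v) \<le> norm (A *v ((1 / norm x) *\<^sub>R x))"
      using subspace_scale[OF R that] False by (intro min) auto
    then have "norm (A *v v) * norm x \<le> norm (A *v x)"
      using False by (simp add: matrix_vector_mult_scaleR field_simps)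
    then have "(norm (A *v v) * norm x)\<^sup>2 \<le> (norm (A *v x))\<^sup>2"
      by (intro power_mono) auto
    then show ?thesis by (simp add: l_def power_mult_distrib)
  qed simp
  have "A *v v \<noteq> 0"
    using v mult_transpose_eq_0[of A] unfolding R_def by (metis imageE norm_zero zero_neq_one)
  then have "l > 0" by (simp add: l_def)
  \<comment> \<open>The defect in the eigenvector equation. It lies in the row space, so
    \<open>v\<close> may be perturbed along it.\<close>
  define w where "w = ?T *v (A *v v) - l *\<^sub>R v"
  have "w \<in> R"
    unfolding w_def using v by (intro subspace_diff[OF R] subspace_scale[OF R]) (auto simp: R_def)
  define c where "c = (norm (A *v w))\<^sup>2 - l * (norm w)\<^sup>2"
  have "c \<ge> 0" using ge[OF \<open>w \<in> R\<close>] by (simp add: c_def)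
  have ww: "(A *v v) \<bullet> (A *v w) - l * (v \<bullet> w) = (norm w)\<^sup>2"
  proof -
    have "(A *v v) \<bullet> (A *v w) = w \<bullet> (?T *v (A *v v))"
      by (metis inner_commute matrix_vector_adjoint)
    then show ?thesis
      unfolding power2_norm_eq_inner
      by (simp add: w_def inner_diff_right inner_commute algebra_simps)
  qed
  have q: "0 \<le> 2 * t * (norm w)\<^sup>2 + t\<^sup>2 * c" for t
  proof -
    have "l * (norm (v + t *\<^sub>R w))\<^sup>2 \<le> (norm (A *v (v + t *\<^sub>R w)))\<^sup>2"
      using \<open>w \<in> R\<close> v by (intro ge subspace_add[OF R] subspace_scale[OF R])
    moreover have "(norm (v + t *\<^sub>R w))\<^sup>2 = 1 + 2 * t * (v \<bullet> w) + t\<^sup>2 * (norm w)\<^sup>2"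
      by (simp add: norm_add_scaleR_sq v(2))
    moreover have "(norm (A *v (v + t *\<^sub>R w)))\<^sup>2
        = l + 2 * t * ((A *v v) \<bullet> (A *v w)) + t\<^sup>2 * (norm (A *v w))\<^sup>2"
      unfolding l_def
      by (simp add: norm_add_scaleR_sq matrix_vector_right_distrib matrix_vector_mult_scaleR)
    ultimately show ?thesis
      unfolding c_def ww[symmetric] by (simp add: algebra_simps)
  qed
  have "w = 0"
  proof (rule ccontr)
    assume "w \<noteq> 0"
    define s where "s = (norm w)\<^sup>2"
    have "s > 0" using \<open>w \<noteq> 0\<close> by (simp add: s_def)
    \<comment> \<open>A small negative \<open>t\<close> makes the linear term dominate; the
      \<open>+ 1\<close> keeps the denominator positive when \<open>c\<close> is 0.\<close>
    have "0 \<le> 2 * (- s / (c + 1)) * s + (- s / (c + 1))\<^sup>2 * c"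
      using q s_def by blast
    also have "\<dots> = - (s\<^sup>2 * (c + 2)) / (c + 1)\<^sup>2"
      using \<open>c \<ge> 0\<close> by (simp add: divide_simps) (simp add: power2_eq_square algebra_simps)
    also have "\<dots> < 0"
      using \<open>c \<ge> 0\<close> \<open>s > 0\<close> by (simp add: divide_simps)
    finally show False by simp
  qed
  show thesis
  proof (rule that)
    show "v \<noteq> 0" using v(2) by auto
    show "l > 0" by fact
    show "(?T ** A) *v v = l *\<^sub>R v"
      using \<open>w = 0\<close> by (simp add: w_def matrix_vector_mul_assoc)
    show "l * (norm (?T *v y))\<^sup>2 \<le> (norm (A *v (?T *v y)))\<^sup>2" for y
      by (rule ge) (simp add: R_def)
  qed
qed

text \<open>The eigenvalue of the minimiser makes the set under \<open>Min\<close> nonempty.\<close>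

lemma sigma_min_pos:
  fixes A :: "real^'n^'m"
  assumes "A \<noteq> 0"
  shows "0 < sigma_min A"
proof -
  obtain v l where "v \<noteq> 0" "l > 0" "(transpose A ** A) *v v = l *\<^sub>R v"
    using row_space_minimiser[OF assms] by metis
  then have "sqrt l \<in> {s \<in> singular_values A. s \<noteq> 0}"
    unfolding singular_values_def by auto
  moreover have "finite {s \<in> singular_values A. s \<noteq> 0}"
    using finite_singular_values[of A] by simp
  ultimately have "sigma_min A \<in> {s \<in> singular_values A. s \<noteq> 0}"
    unfolding sigma_min_def by (intro Min_in) auto
  then show ?thesis
    using singular_values_nonneg[of "sigma_min A" A] by simp
qed

lemma sigma_min_le_row_space:
  fixes A :: "real^'n^'m"
  assumes "A \<noteq> 0"
  shows "sigma_min A * norm (transpose A *v y) \<le> norm (A *v (transpose A *v y))"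
proof -
  obtain v l where vl: "v \<noteq> 0" "l > 0" "(transpose A ** A) *v v = l *\<^sub>R v"
    and ge: "\<And>y. l * (norm (transpose A *v y))\<^sup>2 \<le> (norm (A *v (transpose A *v y)))\<^sup>2"
    using row_space_minimiser[OF assms] by metis
  have "sqrt l \<in> {s \<in> singular_values A. s \<noteq> 0}"
    using vl unfolding singular_values_def by auto
  then have "sigma_min A \<le> sqrt l"
    unfolding sigma_min_def using finite_singular_values[of A] by (intro Min_le) auto
  then have "sigma_min A * norm (transpose A *v y) \<le> sqrt l * norm (transpose A *v y)"
    by (intro mult_right_mono) auto
  also have "\<dots> \<le> norm (A *v (transpose A *v y))"
    using real_sqrt_le_mono[OF ge[of y]] by (simp add: real_sqrt_mult)
  finally show ?thesis .
qed

text \<open>Transfers the bound from \<open>A\<close> on its row space to \<open>transpose A\<close>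
  on the range of \<open>A\<close> by Cauchy-Schwarz, without comparing the singular values of the
  two matrices.\<close>

lemma sigma_min_le_column_space:
  fixes A :: "real^'n^'m"
  assumes "A \<noteq> 0"
  shows "sigma_min A * norm (A *v z) \<le> norm (transpose A *v (A *v z))"
proof (cases "A *v z = 0")
  case False
  obtain y where "A *v (z - transpose A *v y) = 0"
    using kernel_row_space_decomp by blast
  then have y: "A *v z = A *v (transpose A *v y)"
    by (simp add: matrix_vector_mult_diff_distrib)
  have "(norm (A *v z))\<^sup>2 = (transpose A *v y) \<bullet> (transpose A *v (A *v z))"
    unfolding power2_norm_eq_inner by (metis y matrix_vector_adjoint)
  also have "\<dots> \<le> norm (transpose A *v y) * norm (transpose A *v (A *v z))"
    by (rule norm_cauchy_schwarz)
  finally have "sigma_min A * (norm (A *v z))\<^sup>2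
      \<le> (sigma_min A * norm (transpose A *v y)) * norm (transpose A *v (A *v z))"
    using sigma_min_pos[OF assms] by (simp add: mult.assoc)
  also have "\<dots> \<le> norm (A *v z) * norm (transpose A *v (A *v z))"
    using sigma_min_le_row_space[OF assms, of y] y by (intro mult_right_mono) auto
  finally have "norm (A *v z) * (sigma_min A * norm (A *v z))
      \<le> norm (A *v z) * norm (transpose A *v (A *v z))"
    by (simp add: power2_eq_square mult_ac)
  then show ?thesis
    using False by simp
qed simp

lemma sigma_min_power4_le:
  fixes A :: "real^'n^'m"
  assumes "A \<noteq> 0"
  shows "sigma_min A ^ 4 * (norm (A *v z))\<^sup>2 \<le> (norm (A *v (transpose A *v (A *v z))))\<^sup>2"
proof -
  have "sigma_min A * (sigma_min A * norm (A *v z)) \<le> sigma_min A * norm (transpose A *v (A *v z))"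
    using sigma_min_le_column_space[OF assms] sigma_min_pos[OF assms] by (intro mult_left_mono) auto
  also have "\<dots> \<le> norm (A *v (transpose A *v (A *v z)))"
    by (rule sigma_min_le_row_space[OF assms])
  finally have "((sigma_min A)\<^sup>2 * norm (A *v z))\<^sup>2 \<le> (norm (A *v (transpose A *v (A *v z))))\<^sup>2"
    using sigma_min_pos[OF assms] by (intro power_mono) (auto simp: power2_eq_square mult.assoc)
  then show ?thesis
    by (simp add: power_mult_distrib)
qed

section \<open>Frobenius and spectral norms\<close>

lemma frobenius_norm_sq: "(frobenius_norm A)\<^sup>2 = (\<Sum>i\<in>UNIV. (norm (row i A))\<^sup>2)"
  by (simp add: frobenius_norm_def sum_nonneg norm_vec_def L2_set_def row_def)

lemma frobenius_norm_pos:
  assumes "(A :: real^'n^'m) \<noteq> 0"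
  shows "0 < (frobenius_norm A)\<^sup>2"
proof -
  obtain i where "A $ i \<noteq> 0"
    using assms by (auto simp: vec_eq_iff)
  then have "0 < (norm (row i A))\<^sup>2"
    by (simp add: row_def vec_nth_inverse)
  also have "\<dots> \<le> (frobenius_norm A)\<^sup>2"
    unfolding frobenius_norm_sq by (rule member_le_sum) auto
  finally show ?thesis .
qed

lemma norm_mult_le_spectral_norm: "norm (A *v x) \<le> spectral_norm A * norm x"
  unfolding spectral_norm_def by (rule onorm) (rule matrix_vector_mul_bounded_linear)

lemma spectral_norm_pos:
  assumes "(A :: real^'n^'m) \<noteq> 0"
  shows "0 < spectral_norm A"
proof -
  obtain x where "A *v x \<noteq> 0"
    using assms by (metis matrix_eq matrix_vector_mult_0)
  then have "0 < norm (A *v x)" by simp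
  also have "\<dots> \<le> spectral_norm A * norm x"
    by (rule norm_mult_le_spectral_norm)
  finally show ?thesis
    by (metis norm_ge_zero not_le zero_less_mult_iff)
qed

section \<open>Error recursion and contraction in one step\<close>

lemma snd_rkas_state: "snd (rkas_state A b s k) = A *v rkas_iterate A b s k - b"
  unfolding rkas_iterate_def
  by (induction k)
     (auto simp: rkas_step_def Let_def case_prod_beta matrix_vector_mult_diff_distrib
       matrix_vector_mult_scaleR)

text \<open>The projection of \<open>e\<close> onto the orthogonal complement of \<open>u\<close>;
  for \<open>u = 0\<close> division by zero makes it the identity.\<close>

definition line_step :: "'a::real_inner \<Rightarrow> 'a \<Rightarrow> 'a" where
  "line_step u e = e - ((u \<bullet> e) / (norm u)\<^sup>2) *\<^sub>R u"

lemma norm_line_step_sq: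
  "(norm (line_step u e))\<^sup>2 = (norm e)\<^sup>2 - (u \<bullet> e)\<^sup>2 / (norm u)\<^sup>2"
proof (cases "u = 0")
  case False
  then have "u \<bullet> u \<noteq> 0" by simp
  then show ?thesis
    unfolding line_step_def power2_norm_eq_inner
    by (simp add: inner_diff inner_commute power2_eq_square field_simps)
qed (simp add: line_step_def)

text \<open>
  The residual \<open>A x - b\<close> and the error \<open>A x - A A\<^sup>\<dagger> b\<close> differ by a vector orthogonal to the range
  of \<open>A\<close>, so the stepsize computed from the residual equals the one computed from the error.
\<close>

lemma rkas_error_Suc:
  fixes A :: "real^'n^'m"
  assumes "transpose A *v c = transpose A *v b"
  shows "A *v rkas_iterate A b s (Suc k) - c = line_step (A *v row (s k) A) (A *v rkas_iterate A b s k - c)"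
proof -
  have eq: "(A *v row (s k) A) \<bullet> (A *v rkas_iterate A b s k - b)
      = (A *v row (s k) A) \<bullet> (A *v rkas_iterate A b s k - c)"
    using assms by (simp add: matrix_vector_adjoint matrix_vector_mult_diff_distrib)
  show ?thesis
    using eq snd_rkas_state[of A b s k]
    by (simp add: rkas_iterate_def rkas_step_def Let_def case_prod_beta line_step_def
        matrix_vector_mult_diff_distrib matrix_vector_mult_scaleR)
qed

definition rkas_rate :: "real^'n^'m \<Rightarrow> real" where
  "rkas_rate A = 1 - sigma_min A ^ 4 / ((spectral_norm A)\<^sup>2 * (frobenius_norm A)\<^sup>2)"

text \<open>The sum is the mean squared error after one step from a fixed error; requiring the form
  \<open>A *v z\<close> puts the error in the range of \<open>A\<close>, where
  \<open>sigma_min\<close> gives a lower bound.\<close>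

lemma one_step_contraction:
  fixes A :: "real^'n^'m"
  assumes "A \<noteq> 0"
  shows "(\<Sum>i\<in>UNIV. (norm (row i A))\<^sup>2 / (frobenius_norm A)\<^sup>2
            * (norm (line_step (A *v row i A) (A *v z)))\<^sup>2)
         \<le> rkas_rate A * (norm (A *v z))\<^sup>2"
proof -
  let ?F = "(frobenius_norm A)\<^sup>2" and ?S = "(spectral_norm A)\<^sup>2" and ?e = "A *v z"
  let ?g = "A *v (transpose A *v ?e)"
  have F: "0 < ?F" by (rule frobenius_norm_pos[OF assms])
  have S: "0 < ?S" using spectral_norm_pos[OF assms] by simp
  have comp: "(A *v row i A) \<bullet> ?e = ?g $ i" for i
    by (simp add: matrix_vector_adjoint) (simp add: matrix_vector_mul_component row_def vec_nth_inverse)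
  \<comment> \<open>The row weight offsets the denominator up to the factor \<open>?S\<close>. If
    \<open>A *v row i A\<close> vanishes, \<open>comp\<close> makes both sides 0.\<close>
  have term_le: "(?g $ i)\<^sup>2 / ?S \<le> (norm (row i A))\<^sup>2 * (((A *v row i A) \<bullet> ?e)\<^sup>2 / (norm (A *v row i A))\<^sup>2)" for i
  proof (cases "A *v row i A = 0")
    case True
    then show ?thesis using comp[of i] by simp
  next
    case False
    have "(norm (A *v row i A))\<^sup>2 \<le> ?S * (norm (row i A))\<^sup>2"
      using power_mono[OF norm_mult_le_spectral_norm, of A "row i A" 2]
      by (simp add: power_mult_distrib)
    then have "(?g $ i)\<^sup>2 * (norm (A *v row i A))\<^sup>2 \<le> (?g $ i)\<^sup>2 * (?S * (norm (row i A))\<^sup>2)"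
      by (intro mult_left_mono) auto
    then show ?thesis
      using False S unfolding comp by (simp add: field_simps)
  qed
  have "sigma_min A ^ 4 * (norm ?e)\<^sup>2 / ?S \<le> (norm ?g)\<^sup>2 / ?S"
    using sigma_min_power4_le[OF assms] S by (intro divide_right_mono) auto
  also have "\<dots> = (\<Sum>i\<in>UNIV. (?g $ i)\<^sup>2 / ?S)"
    by (simp add: norm_vec_def L2_set_def sum_nonneg sum_divide_distrib)
  also have "\<dots> \<le> (\<Sum>i\<in>UNIV. (norm (row i A))\<^sup>2 * (((A *v row i A) \<bullet> ?e)\<^sup>2 / (norm (A *v row i A))\<^sup>2))"
    by (intro sum_mono term_le)
  finally have decrease: "sigma_min A ^ 4 * (norm ?e)\<^sup>2 / ?S
    \<le> (\<Sum>i\<in>UNIV. (norm (row i A))\<^sup>2 * (((A *v row i A) \<bullet> ?e)\<^sup>2 / (norm (A *v row i A))\<^sup>2))"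
    (is "?L \<le> ?D") .
  have "(\<Sum>i\<in>UNIV. (norm (row i A))\<^sup>2 / ?F * (norm (line_step (A *v row i A) ?e))\<^sup>2)
      = (\<Sum>i\<in>UNIV. (norm (row i A))\<^sup>2 * (norm (line_step (A *v row i A) ?e))\<^sup>2) / ?F"
    by (simp add: sum_divide_distrib)
  also have "\<dots> = (?F * (norm ?e)\<^sup>2 - ?D) / ?F"
    unfolding norm_line_step_sq frobenius_norm_sq
    by (simp add: right_diff_distrib sum_subtractf sum_distrib_right)
  also have "\<dots> \<le> (?F * (norm ?e)\<^sup>2 - ?L) / ?F"
    using decrease F by (intro divide_right_mono) auto
  also have "\<dots> = rkas_rate A * (norm ?e)\<^sup>2"
    using F S unfolding rkas_rate_def by (simp add: field_simps)
  finally show ?thesis .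
qed

text \<open>Read off from \<open>one_step_contraction\<close> at a nonzero \<open>A *v z\<close>,
  whose left side is a sum of nonnegative terms.\<close>

lemma rkas_rate_nonneg:
  fixes A :: "real^'n^'m"
  assumes "A \<noteq> 0"
  shows "0 \<le> rkas_rate A"
proof -
  obtain z where z: "A *v z \<noteq> 0"
    using assms by (metis matrix_eq matrix_vector_mult_0)
  have "0 \<le> (\<Sum>i\<in>UNIV. (norm (row i A))\<^sup>2 / (frobenius_norm A)\<^sup>2
            * (norm (line_step (A *v row i A) (A *v z)))\<^sup>2)"
    by (intro sum_nonneg) auto
  also have "\<dots> \<le> rkas_rate A * (norm (A *v z))\<^sup>2"
    by (rule one_step_contraction[OF assms])
  finally show ?thesis
    using z by (simp add: zero_le_mult_iff)
qed

section \<open>Expectations over the index history\<close>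

lemma rkas_state_cong:
  assumes "\<And>j. j < k \<Longrightarrow> s j = t j"
  shows "rkas_state A b s k = rkas_state A b t k"
  using assms by (induction k) auto

lemma measurable_history:
  fixes h :: "(nat \<Rightarrow> 'm::finite) \<Rightarrow> real"
  shows "h \<in> borel_measurable (PiM {..<k} (\<lambda>_. count_space UNIV))"
  by (subst count_space_PiM_finite) auto

text \<open>A function of finitely many finite-valued variables takes finitely many values, so it is
  bounded.\<close>

lemma (in prob_space) integrable_history:
  fixes X :: "nat \<Rightarrow> 'a \<Rightarrow> 'm::finite" and h :: "(nat \<Rightarrow> 'm) \<Rightarrow> real"
  assumes X: "\<And>j. X j \<in> measurable M (count_space UNIV)"
    and hist: "\<And>s t. (\<And>j. j < k \<Longrightarrow> s j = t j) \<Longrightarrow> h s = h t"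
  shows "integrable M (\<lambda>\<omega>. h (\<lambda>j. X j \<omega>))"
proof -
  let ?X = "\<lambda>\<omega>. restrict (\<lambda>j. X j \<omega>) {..<k}"
  let ?P = "PiE {..<k} (\<lambda>_. UNIV :: 'm set)"
  have "?X \<in> measurable M (PiM {..<k} (\<lambda>_. count_space UNIV))"
    using X by (intro measurable_restrict) auto
  then have "(\<lambda>\<omega>. h (?X \<omega>)) \<in> borel_measurable M"
    by (rule measurable_compose[OF _ measurable_history])
  moreover have "AE \<omega> in M. norm (h (?X \<omega>)) \<le> Max ((\<lambda>s. norm (h s)) ` ?P)"
    by (intro AE_I2 Max_ge finite_imageI finite_PiE imageI restrict_PiE_iff[THEN iffD2]) auto
  ultimately have "integrable M (\<lambda>\<omega>. h (?X \<omega>))"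
    by (rule integrable_const_bound[rotated])
  moreover have "h (?X \<omega>) = h (\<lambda>j. X j \<omega>)" for \<omega>
    by (rule hist) simp
  ultimately show ?thesis by simp
qed

text \<open>A discrete substitute for conditioning on the past: split by the value of
  \<open>X k\<close>, whose indicator is independent of the earlier indices.\<close>

lemma (in prob_space) expectation_history_next:
  fixes X :: "nat \<Rightarrow> 'a \<Rightarrow> 'm::finite" and h :: "(nat \<Rightarrow> 'm) \<Rightarrow> 'm \<Rightarrow> real"
  assumes indep: "indep_vars (\<lambda>_. count_space UNIV) X UNIV"
    and hist: "\<And>s t i. (\<And>j. j < k \<Longrightarrow> s j = t j) \<Longrightarrow> h s i = h t i"
  shows "expectation (\<lambda>\<omega>. h (\<lambda>j. X j \<omega>) (X k \<omega>))
       = (\<Sum>i\<in>UNIV. prob {\<omega> \<in> space M. X k \<omega> = i} * expectation (\<lambda>\<omega>. h (\<lambda>j. X j \<omega>) i))"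
proof -
  let ?ind = "\<lambda>i \<omega>. indicator {i} (X k \<omega>) :: real"
  have X: "X j \<in> measurable M (count_space UNIV)" for j
    using indep by (auto simp: indep_vars_def)
  have int: "integrable M (\<lambda>\<omega>. h (\<lambda>j. X j \<omega>) i)" for i
    by (rule integrable_history[OF X hist])
  have ind: "?ind i \<omega> = indicator {\<omega> \<in> space M. X k \<omega> = i} \<omega>" if "\<omega> \<in> space M" for i \<omega>
    using that by (auto simp: indicator_def)
  have ev: "{\<omega> \<in> space M. X k \<omega> = i} \<in> events" for i
    using X by measurable
  have int_ind: "integrable M (?ind i)" for i
    using ev[of i] by (subst Bochner_Integration.integrable_cong[OF refl ind]) (auto simp: emeasure_eq_measure)
  have exp_ind: "expectation (?ind i) = prob {\<omega> \<in> space M. X k \<omega> = i}" for i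
    using ev[of i] by (subst Bochner_Integration.integral_cong[OF refl ind]) (auto simp: Int_absorb1)
  have indep_i: "indep_var borel (?ind i) borel (\<lambda>\<omega>. h (\<lambda>j. X j \<omega>) i)" for i
  proof -
    \<comment> \<open>The index blocks \<open>{k}\<close> and \<open>{..<k}\<close> are disjoint.
      Restricting the history does not change \<open>h\<close>, by \<open>hist\<close>.\<close>
    have r: "indep_var (PiM {k} (\<lambda>_. count_space UNIV)) (\<lambda>\<omega>. restrict (\<lambda>j. X j \<omega>) {k})
        (PiM {..<k} (\<lambda>_. count_space UNIV)) (\<lambda>\<omega>. restrict (\<lambda>j. X j \<omega>) {..<k})"
      by (rule indep_var_restrict[OF indep]) auto
    have m1: "(\<lambda>s. indicator {i} (s k) :: real) \<in> borel_measurable (PiM {k} (\<lambda>_. count_space UNIV))"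
      by measurable
    have "indep_var borel ((\<lambda>s. indicator {i} (s k) :: real) \<circ> (\<lambda>\<omega>. restrict (\<lambda>j. X j \<omega>) {k}))
        borel ((\<lambda>s. h s i) \<circ> (\<lambda>\<omega>. restrict (\<lambda>j. X j \<omega>) {..<k}))"
      by (rule indep_var_compose[OF r m1 measurable_history])
    moreover have "h (restrict (\<lambda>j. X j \<omega>) {..<k}) i = h (\<lambda>j. X j \<omega>) i" for \<omega>
      by (rule hist) simp
    ultimately show ?thesis
      by (simp add: comp_def)
  qed
  have "expectation (\<lambda>\<omega>. h (\<lambda>j. X j \<omega>) (X k \<omega>))
      = expectation (\<lambda>\<omega>. \<Sum>i\<in>UNIV. ?ind i \<omega> * h (\<lambda>j. X j \<omega>) i)"
    by (simp add: indicator_def)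
  also have "\<dots> = (\<Sum>i\<in>UNIV. expectation (\<lambda>\<omega>. ?ind i \<omega> * h (\<lambda>j. X j \<omega>) i))"
    by (intro Bochner_Integration.integral_sum indep_var_integrable[OF indep_i] int_ind int)
  also have "\<dots> = (\<Sum>i\<in>UNIV. expectation (?ind i) * expectation (\<lambda>\<omega>. h (\<lambda>j. X j \<omega>) i))"
    by (intro sum.cong refl indep_var_lebesgue_integral[OF indep_i] int_ind int)
  finally show ?thesis
    by (simp add: exp_ind)
qed

text \<open>The error before step \<open>k\<close> depends only on indices below \<open>k\<close>,
  so averaging over \<open>idx k\<close> reduces the claim to \<open>one_step_contraction\<close>
  under the integral.\<close>

lemma (in prob_space) rkas_expected_contraction:
  fixes A :: "real^'n^'m" and b :: "real^'m"
  assumes "A \<noteq> 0" and sel: "rkas_selection A idx"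
    and c: "transpose A *v (A *v y) = transpose A *v b"
  shows "expectation (\<lambda>\<omega>. (norm (A *v rkas_iterate A b (\<lambda>j. idx j \<omega>) (Suc k) - A *v y))\<^sup>2)
    \<le> rkas_rate A * expectation (\<lambda>\<omega>. (norm (A *v rkas_iterate A b (\<lambda>j. idx j \<omega>) k - A *v y))\<^sup>2)"
proof -
  let ?e = "\<lambda>s. A *v rkas_iterate A b s k - A *v y"
  let ?h = "\<lambda>s i. (norm (line_step (A *v row i A) (?e s)))\<^sup>2"
  have indep: "indep_vars (\<lambda>_. count_space UNIV) idx UNIV"
    and p: "\<And>i. prob {\<omega> \<in> space M. idx k \<omega> = i} = (norm (row i A))\<^sup>2 / (frobenius_norm A)\<^sup>2"
    using sel by (auto simp: rkas_selection_def)
  have e: "integrable M (\<lambda>\<omega>. (norm (?e (\<lambda>j. idx j \<omega>)))\<^sup>2)"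
    by (rule integrable_rkas_error[OF sel])
  have hist: "?h s i = ?h t i" if "\<And>j. j < k \<Longrightarrow> s j = t j" for s t i
    using rkas_state_cong[of k s t A b] that by (simp add: rkas_iterate_def)
  have "\<And>j. idx j \<in> measurable M (count_space UNIV)"
    using indep by (auto simp: indep_vars_def)
  then have int: "integrable M (\<lambda>\<omega>. ?h (\<lambda>j. idx j \<omega>) i)" for i
    using hist by (rule integrable_history)
  have "expectation (\<lambda>\<omega>. (norm (A *v rkas_iterate A b (\<lambda>j. idx j \<omega>) (Suc k) - A *v y))\<^sup>2)
      = expectation (\<lambda>\<omega>. ?h (\<lambda>j. idx j \<omega>) (idx k \<omega>))"
    by (simp add: rkas_error_Suc[OF c])
  also have "\<dots> = (\<Sum>i\<in>UNIV. prob {\<omega> \<in> space M. idx k \<omega> = i} * expectation (\<lambda>\<omega>. ?h (\<lambda>j. idx j \<omega>) i))"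
    by (rule expectation_history_next[OF indep hist])
  also have "\<dots> = expectation (\<lambda>\<omega>. \<Sum>i\<in>UNIV. (norm (row i A))\<^sup>2 / (frobenius_norm A)\<^sup>2 * ?h (\<lambda>j. idx j \<omega>) i)"
    using int by (subst Bochner_Integration.integral_sum) (auto simp: p)
  also have "\<dots> \<le> expectation (\<lambda>\<omega>. rkas_rate A * (norm (?e (\<lambda>j. idx j \<omega>)))\<^sup>2)"
    using one_step_contraction[OF assms(1), of "rkas_iterate A b _ k - y"]
    by (intro integral_mono Bochner_Integration.integrable_sum integrable_mult_right int e)
       (simp add: matrix_vector_mult_diff_distrib)
  finally show ?thesis
    by simp
qed

theorem theorem3p1:
  fixes A :: "real^'n^'m" and b :: "real^'m"
    and M :: "'w measure" and idx :: "nat \<Rightarrow> 'w \<Rightarrow> 'm" and k :: nat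
  assumes "A \<noteq> 0"
    and "prob_space M"
    and "prob_space.rkas_selection M A idx"
  shows "prob_space.expectation M
           (\<lambda>\<omega>. (norm (A *v rkas_iterate A b (\<lambda>j. idx j \<omega>) k - A *v (pseudoinverse A *v b)))\<^sup>2)
         \<le> (1 - (sigma_min A) ^ 4 / ((spectral_norm A)\<^sup>2 * (frobenius_norm A)\<^sup>2)) ^ k
            * (norm (A *v 0 - A *v (pseudoinverse A *v b)))\<^sup>2"
proof -
  interpret prob_space M by fact
  let ?E = "\<lambda>k. expectation (\<lambda>\<omega>.
    (norm (A *v rkas_iterate A b (\<lambda>j. idx j \<omega>) k - A *v (pseudoinverse A *v b)))\<^sup>2)"
  have "?E k \<le> rkas_rate A ^ k * (norm (A *v 0 - A *v (pseudoinverse A *v b)))\<^sup>2"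
  proof (induction k)
    case 0
    show ?case by (simp add: rkas_iterate_def prob_space)
  next
    case (Suc k)
    have "?E (Suc k) \<le> rkas_rate A * ?E k"
      by (rule rkas_expected_contraction[OF assms(1,3) transpose_mult_pseudoinverse])
    \<comment> \<open>Multiplying the induction hypothesis by the rate is sound because the rate is
      nonnegative.\<close>
    also have "\<dots> \<le> rkas_rate A * (rkas_rate A ^ k * (norm (A *v 0 - A *v (pseudoinverse A *v b)))\<^sup>2)"
      by (rule mult_left_mono[OF Suc rkas_rate_nonneg[OF assms(1)]])
    finally show ?case by (simp add: mult.assoc)
  qed
  then show ?thesis
    by (simp add: rkas_rate_def)
qed

end
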